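(* Let $n\ge1$. Let $J$ be the almost complex structure on the symplectization $\tilde P$ of the manifold $(P,\phi,\xi,\theta)$, regarded as the product $P\times\mathbb{R}$ with coordinate $t$ on the factor $\mathbb{R}$, defined by $$J(X,f\partial_t)=(\phi(X)-f\xi,\ \theta(X)\partial_t)$$ for $X$ tangent to $P$ and $f$ a function on $\tilde P$. Then the Nijenhuis tensor $N_J$ of $J$ is identically zero. As a result, $(\tilde P,J)$ is a complex manifold and $(P,\phi,\xi,\theta)$ is an indefinite Sasakian manifold.
   Context: $P=\mathbb{R}^{2n+1}$ has coordinates $(x^0;p_1,\dots,p_n;x^1,\dots,x^n)$, contact form $\theta=dx^0+\sum_{i=1}^np_i\,dx^i$, and Reeb field $\xi=\partial_{x^0}$. Put $P_i=\partial_{p_i}$, $X_i=\partial_{x^i}-p_i\partial_{x^0}$. The $(1,1)$-tensor field $\phi$ on $P$ is given in the coordinate frame, ordered as $(\partial_{x^0};\partial_{p_1},\dots,\partial_{p_n};\partial_{x^1},\dots,\partial_{x^n})$, by the matrix $$\phi=\begin{pmatrix}0&(p_1,\dots,p_n)&0\\0&0_n&I_n\\0&-I_n&0_n\end{pmatrix},$$ so that $\phi(\xi)=0$, $\phi(X_i)=P_i$, $\phi(P_i)=-X_i$. It satisfies $\phi^2=-I+\theta\otimes\xi$ and $\theta(\xi)=1$. $\tilde P=\mathbb{R}^{2n+2}$ is considered as the product $P\times\mathbb{R}$ (the coordinate $t$ stands for $p_0$), and tangent vectors are written as pairs $(X,f\partial_t)$. Thus $J\xi=\partial_t$, $J\partial_t=-\xi$,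 $JX_i=P_i$ and $JP_i=-X_i$. The Nijenhuis tensor is $N_J(X,Y)=J^2[X,Y]+[JX,JY]-J[JX,Y]-J[X,JY]$. "Indefinite Sasakian" means that the almost complex structure $J$ so defined is integrable (the metric associated with the contact structure being indefinite); "complex manifold" means that $J$ comes from a complex structure. *)

theory Defs
  imports "HOL-Analysis.Analysis"
begin

section \<open>Smooth maps and vector fields on Euclidean spaces\<close>

text \<open>All manifolds below are Euclidean spaces, with the identity as global chart. A vector field is a map from the
  space to itself, and a tensor field takes the base point as its first argument.\<close>

primrec Ck_on :: "nat \<Rightarrow> ('a::euclidean_space \<Rightarrow> 'b::euclidean_space) \<Rightarrow> 'a set \<Rightarrow> bool" where
  "Ck_on 0 f S \<longleftrightarrow> continuous_on S f"
| "Ck_on (Suc k) f S \<longleftrightarrow> (\<forall>x\<in>S. f differentiable (at x)) \<and>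
     (\<forall>v. Ck_on k (\<lambda>x. frechet_derivative f (at x) v) S)"

text \<open>The derivatives are taken at full neighbourhoods, so \<open>S\<close> is meant to be open.\<close>

definition smooth_on :: "('a::euclidean_space \<Rightarrow> 'b::euclidean_space) \<Rightarrow> 'a set \<Rightarrow> bool" where
  "smooth_on f S \<longleftrightarrow> (\<forall>k. Ck_on k f S)"

abbreviation smooth :: "('a::euclidean_space \<Rightarrow> 'b::euclidean_space) \<Rightarrow> bool" where
  "smooth f \<equiv> smooth_on f UNIV"

definition lie_bracket :: "('a::euclidean_space \<Rightarrow> 'a) \<Rightarrow> ('a \<Rightarrow> 'a) \<Rightarrow> 'a \<Rightarrow> 'a" where
  "lie_bracket X Y = (\<lambda>z. frechet_derivative Y (at z) (X z) - frechet_derivative X (at z) (Y z))"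

definition nijenhuis ::
    "('a::euclidean_space \<Rightarrow> 'a \<Rightarrow> 'a) \<Rightarrow> ('a \<Rightarrow> 'a) \<Rightarrow> ('a \<Rightarrow> 'a) \<Rightarrow> 'a \<Rightarrow> 'a" where
  "nijenhuis J X Y = (\<lambda>z.
       J z (J z (lie_bracket X Y z))
     + lie_bracket (\<lambda>w. J w (X w)) (\<lambda>w. J w (Y w)) z
     - J z (lie_bracket (\<lambda>w. J w (X w)) Y z)
     - J z (lie_bracket X (\<lambda>w. J w (Y w)) z))"

definition tensor11 :: "('a::euclidean_space \<Rightarrow> 'a \<Rightarrow> 'a) \<Rightarrow> bool" where
  "tensor11 T \<longleftrightarrow> (\<forall>z. linear (T z)) \<and> (\<forall>v. smooth (\<lambda>z. T z v))"

definition one_form :: "('a::euclidean_space \<Rightarrow> 'a \<Rightarrow> real) \<Rightarrow> bool" where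
  "one_form \<alpha> \<longleftrightarrow> (\<forall>z. linear (\<alpha> z)) \<and> (\<forall>v. smooth (\<lambda>z. \<alpha> z v))"

text \<open>Exterior derivative of a 1-form, normalised by
  \<open>d\<alpha>(X,Y) = X(\<alpha>(Y)) - Y(\<alpha>(X)) - \<alpha>([X,Y])\<close>, evaluated on constant fields \<open>u\<close>, \<open>v\<close>.\<close>

definition ext_deriv :: "('a::euclidean_space \<Rightarrow> 'a \<Rightarrow> real) \<Rightarrow> 'a \<Rightarrow> 'a \<Rightarrow> 'a \<Rightarrow> real" where
  "ext_deriv \<alpha> z u v = frechet_derivative (\<lambda>w. \<alpha> w v) (at z) u
                     - frechet_derivative (\<lambda>w. \<alpha> w u) (at z) v"

section \<open>The contact space and its symplectization\<close>

text \<open>A point of the contact space is \<open>(x\<^sup>0, p, x)\<close>. A tangent vector \<open>(a, u, v)\<close> has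
  its components with respect to \<open>\<partial>/\<partial>x\<^sup>0\<close>, \<open>\<partial>/\<partial>p\<^sub>i\<close>, \<open>\<partial>/\<partial>x\<^sup>i\<close>.\<close>

type_synonym 'n phase = "real \<times> (real^'n) \<times> (real^'n)"
type_synonym 'n sympl = "'n phase \<times> real"

definition contact_theta :: "'n::finite phase \<Rightarrow> 'n phase \<Rightarrow> real" where
  "contact_theta = (\<lambda>(x0, p, x) (a, u, v). a + (\<Sum>i\<in>UNIV. p $ i * v $ i))"

definition contact_xi :: "'n::finite phase \<Rightarrow> 'n phase" where
  "contact_xi = (\<lambda>z. (1, 0, 0))"

text \<open>The block matrix with rows \<open>(0, p, 0)\<close>, \<open>(0, 0, I)\<close>, \<open>(0, -I, 0)\<close> applied to the
  column \<open>(a, u, v)\<close>.\<close>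

definition contact_phi :: "'n::finite phase \<Rightarrow> 'n phase \<Rightarrow> 'n phase" where
  "contact_phi = (\<lambda>(x0, p, x) (a, u, v). ((\<Sum>i\<in>UNIV. p $ i * u $ i), v, - u))"

definition sympl_J :: "('n::finite phase \<Rightarrow> 'n phase \<Rightarrow> 'n phase) \<Rightarrow> ('n phase \<Rightarrow> 'n phase) \<Rightarrow>
    ('n phase \<Rightarrow> 'n phase \<Rightarrow> real) \<Rightarrow> 'n sympl \<Rightarrow> 'n sympl \<Rightarrow> 'n sympl" where
  "sympl_J \<phi> \<xi> \<theta> = (\<lambda>(m, t) (X, f). (\<phi> m X - f *\<^sub>R \<xi> m, \<theta> m X))"

section \<open>Complex structures\<close>

definition almost_complex :: "('a::euclidean_space \<Rightarrow> 'a \<Rightarrow> 'a) \<Rightarrow> bool" where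
  "almost_complex J \<longleftrightarrow> tensor11 J \<and> (\<forall>z v. J z (J z v) = - v)"

definition cholomorphic_on :: "(complex^'m::finite \<Rightarrow> complex^'m) \<Rightarrow> (complex^'m) set \<Rightarrow> bool" where
  "cholomorphic_on f S \<longleftrightarrow>
     (\<forall>z\<in>S. \<exists>D. (f has_derivative D) (at z) \<and> (\<forall>c v. D (c *s v) = c *s D v))"

text \<open>A chart is a diffeomorphism, for the given smooth structure, from an open set onto an open
  subset of complex coordinate space.\<close>

definition complex_atlas :: "('a::euclidean_space set \<times> ('a \<Rightarrow> complex^'m::finite)) set \<Rightarrow> bool" where
  "complex_atlas A \<longleftrightarrow>
     (\<Union>(U, \<psi>)\<in>A. U) = UNIV \<and>
     (\<forall>(U, \<psi>)\<in>A. open U \<and> open (\<psi> ` U) \<and> inj_on \<psi> U \<and>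
        smooth_on \<psi> U \<and> smooth_on (inv_into U \<psi>) (\<psi> ` U)) \<and>
     (\<forall>(U, \<psi>)\<in>A. \<forall>(V, \<eta>)\<in>A. cholomorphic_on (\<eta> \<circ> inv_into U \<psi>) (\<psi> ` (U \<inter> V)))"

definition induces_acs ::
    "('a::euclidean_space set \<times> ('a \<Rightarrow> complex^'m::finite)) set \<Rightarrow> ('a \<Rightarrow> 'a \<Rightarrow> 'a) \<Rightarrow> bool" where
  "induces_acs A J \<longleftrightarrow> (\<forall>(U, \<psi>)\<in>A. \<forall>z\<in>U. \<forall>v.
     frechet_derivative \<psi> (at z) (J z v) = \<i> *s frechet_derivative \<psi> (at z) v)"

text \<open>The model space \<open>complex^('n option)\<close> has complex dimension \<open>CARD('n) + 1\<close>.\<close>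

definition complex_manifold :: "('n::finite sympl \<Rightarrow> 'n sympl \<Rightarrow> 'n sympl) \<Rightarrow> bool" where
  "complex_manifold J \<longleftrightarrow> almost_complex J \<and>
     (\<exists>A :: ('n sympl set \<times> ('n sympl \<Rightarrow> complex^('n option))) set.
        complex_atlas A \<and> induces_acs A J)"

section \<open>Indefinite Sasakian structures\<close>

definition contact_form :: "('a::euclidean_space \<Rightarrow> 'a \<Rightarrow> real) \<Rightarrow> bool" where
  "contact_form \<theta> \<longleftrightarrow> one_form \<theta> \<and> (\<forall>z. \<theta> z \<noteq> (\<lambda>_. 0)) \<and>
     (\<forall>z u. \<theta> z u = 0 \<and> (\<forall>v. \<theta> z v = 0 \<longrightarrow> ext_deriv \<theta> z u v = 0) \<longrightarrow> u = 0)"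

definition reeb_field :: "('a::euclidean_space \<Rightarrow> 'a) \<Rightarrow> ('a \<Rightarrow> 'a \<Rightarrow> real) \<Rightarrow> bool" where
  "reeb_field \<xi> \<theta> \<longleftrightarrow> smooth \<xi> \<and> (\<forall>z. \<theta> z (\<xi> z) = 1) \<and> (\<forall>z v. ext_deriv \<theta> z (\<xi> z) v = 0)"

definition almost_contact :: "('a::euclidean_space \<Rightarrow> 'a \<Rightarrow> 'a) \<Rightarrow> ('a \<Rightarrow> 'a) \<Rightarrow>
    ('a \<Rightarrow> 'a \<Rightarrow> real) \<Rightarrow> bool" where
  "almost_contact \<phi> \<xi> \<theta> \<longleftrightarrow> tensor11 \<phi> \<and> smooth \<xi> \<and> one_form \<theta> \<and>
     (\<forall>z v. \<phi> z (\<phi> z v) = - v + \<theta> z v *\<^sub>R \<xi> z) \<and> (\<forall>z. \<theta> z (\<xi> z) = 1)"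

definition pseudo_riemannian :: "('a::euclidean_space \<Rightarrow> 'a \<Rightarrow> 'a \<Rightarrow> real) \<Rightarrow> bool" where
  "pseudo_riemannian g \<longleftrightarrow> (\<forall>u v. smooth (\<lambda>z. g z u v)) \<and>
     (\<forall>z. bilinear (g z) \<and> (\<forall>u v. g z u v = g z v u) \<and>
        (\<forall>u. (\<forall>v. g z u v = 0) \<longrightarrow> u = 0))"

definition indefinite_metric :: "('a::euclidean_space \<Rightarrow> 'a \<Rightarrow> 'a \<Rightarrow> real) \<Rightarrow> bool" where
  "indefinite_metric g \<longleftrightarrow> pseudo_riemannian g \<and>
     (\<forall>z. (\<exists>u. g z u u > 0) \<and> (\<exists>u. g z u u < 0))"

text \<open>A metric associated with a contact structure, in the pseudo-Riemannian setting: \<open>\<epsilon> = 1\<close> or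
  \<open>\<epsilon> = -1\<close> is the causal sign of the Reeb field, and \<open>\<epsilon> = 1\<close> is the usual definition of a
  contact metric structure.\<close>

definition associated_metric :: "('a::euclidean_space \<Rightarrow> 'a \<Rightarrow> 'a \<Rightarrow> real) \<Rightarrow> ('a \<Rightarrow> 'a \<Rightarrow> 'a) \<Rightarrow>
    ('a \<Rightarrow> 'a) \<Rightarrow> ('a \<Rightarrow> 'a \<Rightarrow> real) \<Rightarrow> bool" where
  "associated_metric g \<phi> \<xi> \<theta> \<longleftrightarrow> (\<exists>\<epsilon>\<in>{1, -1}. \<forall>z u v.
     \<theta> z u = \<epsilon> * g z u (\<xi> z) \<and>
     g z (\<phi> z u) (\<phi> z v) = g z u v - \<epsilon> * \<theta> z u * \<theta> z v \<and>
     ext_deriv \<theta> z u v = g z u (\<phi> z v))"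

text \<open>An almost contact manifold is normal when the almost complex structure on its product with
  the real line is integrable, i.e. comes from a complex structure. Normality together with an associated
  metric is the Sasakian condition.\<close>

definition indefinite_sasakian :: "('n::finite phase \<Rightarrow> 'n phase \<Rightarrow> 'n phase) \<Rightarrow>
    ('n phase \<Rightarrow> 'n phase) \<Rightarrow> ('n phase \<Rightarrow> 'n phase \<Rightarrow> real) \<Rightarrow> bool" where
  "indefinite_sasakian \<phi> \<xi> \<theta> \<longleftrightarrow>
     almost_contact \<phi> \<xi> \<theta> \<and> contact_form \<theta> \<and> reeb_field \<xi> \<theta> \<and>
     complex_manifold (sympl_J \<phi> \<xi> \<theta>) \<and>
     (\<exists>g. indefinite_metric g \<and> associated_metric g \<phi> \<xi> \<theta>)"

end

theory Submission
  imports Defs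
begin

text \<open>The functions \<open>x\<^sup>j + i p\<^sub>j\<close> and \<open>x\<^sup>0 + i (t - |p|\<^sup>2 / 2)\<close> have differentials that are complex
  linear for \<open>J\<close>, and together they form a global diffeomorphism onto complex coordinate space. The
  Nijenhuis tensor is computed directly: \<open>J\<close> is affine in the base point, so all derivatives of the
  vector fields cancel and an algebraic identity remains. The metric
  \<open>- \<theta> \<otimes> \<theta> + \<Sum> (dp\<^sub>i\<^sup>2 + (dx\<^sup>i)\<^sup>2)\<close>, for which the Reeb field is timelike, is an indefinite metric
  associated with the contact structure; the sign \<open>+ \<theta> \<otimes> \<theta>\<close> would give a definite one.\<close>

section \<open>Smoothness of quadratic maps\<close>

lemma smooth_const: "smooth (\<lambda>_. c)"
proof -
  have "Ck_on k (\<lambda>_::'a. c::'b) UNIV" for k c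
    by (induction k arbitrary: c) (auto simp: frechet_derivative_const)
  then show ?thesis
    by (simp add: smooth_on_def)
qed

text \<open>\<open>Ck_on (Suc k)\<close> asks only for differentiability and \<open>Ck_on k\<close>
  of the directional derivatives, so smoothness of all \<open>D z v\<close> passes to
  \<open>f\<close>. Order 0 is separate and comes from differentiability.\<close>

lemma smooth_derivI:
  assumes "\<And>z. (f has_derivative D z) (at z)" and "\<And>v. smooth (\<lambda>z. D z v)"
  shows "smooth f"
proof -
  have "frechet_derivative f (at z) = D z" for z
    using frechet_derivative_at[OF assms(1)] by simp
  moreover have "f differentiable (at z)" for z
    using assms(1) by (auto simp: differentiable_def)
  moreover from this have "continuous_on UNIV f"
    by (simp add: continuous_at_imp_continuous_on differentiable_imp_continuous_within)
  moreover have "Ck_on k (\<lambda>z. D z v) UNIV" for k v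
    using assms(2) by (simp add: smooth_on_def)
  ultimately have "Ck_on k f UNIV" for k
    by (cases k) simp_all
  then show ?thesis
    by (simp add: smooth_on_def)
qed

lemma smooth_affine:
  fixes L :: "'a::euclidean_space \<Rightarrow> 'b::euclidean_space"
  assumes "linear L"
  shows "smooth (\<lambda>z. c + L z)"
proof (rule smooth_derivI)
  show "((\<lambda>z. c + L z) has_derivative L) (at z)" for z
    using assms by (auto intro!: derivative_eq_intros linear_imp_has_derivative)
qed (rule smooth_const)

text \<open>Each directional derivative is affine in \<open>z\<close>, so
  \<open>smooth_affine\<close> applies to it.\<close>

lemma smooth_quadratic:
  fixes L :: "'a::euclidean_space \<Rightarrow> 'b::euclidean_space"
  assumes L: "linear L" and B: "bilinear B"
  shows "smooth (\<lambda>z. c + L z + B z z)"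
proof (rule smooth_derivI)
  interpret bounded_bilinear B
    using B by (simp add: bilinear_conv_bounded_bilinear)
  show "((\<lambda>z. c + L z + B z z) has_derivative (\<lambda>h. L h + (B z h + B h z))) (at z)" for z
    using L by (auto intro!: derivative_eq_intros linear_imp_has_derivative FDERIV)
  show "smooth (\<lambda>z. L v + (B z v + B v z))" for v
    using B by (intro smooth_affine linear_compose_add) (auto simp: bilinear_def)
qed

lemma smooth_imp_differentiable: "smooth f \<Longrightarrow> f differentiable (at z)"
  unfolding smooth_on_def by (drule spec[of _ "Suc 0"]) simp

section \<open>The Nijenhuis tensor of an affine endomorphism field\<close>

text \<open>The derivative of \<open>J\<close> in direction \<open>h\<close> is the constant
  endomorphism \<open>B h\<close>. The product rule then expands the brackets, and every term with a
  derivative of \<open>X\<close> or \<open>Y\<close> occurs twice with opposite signs.\<close>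

lemma nijenhuis_affine:
  fixes J :: "'a::euclidean_space \<Rightarrow> 'a \<Rightarrow> 'a"
  assumes L: "linear L" and B: "bilinear B" and J: "\<And>z v. J z v = L v + B z v"
    and X: "X differentiable (at z)" and Y: "Y differentiable (at z)"
  shows "nijenhuis J X Y z = B (J z (X z)) (Y z) - B (J z (Y z)) (X z)
    + J z (B (Y z) (X z)) - J z (B (X z) (Y z))"
proof -
  interpret B: bounded_bilinear B
    using B by (simp add: bilinear_conv_bounded_bilinear)
  have deriv_J: "frechet_derivative (\<lambda>w. J w (Z w)) (at z)
      = (\<lambda>h. J z (frechet_derivative Z (at z) h) + B h (Z z))"
    if "Z differentiable (at z)" for Z
  proof -
    have Z: "(Z has_derivative frechet_derivative Z (at z)) (at z)"
      using that by (simp add: frechet_derivative_works)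
    have "((\<lambda>w. L (Z w)) has_derivative (\<lambda>h. L (frechet_derivative Z (at z) h))) (at z)"
      by (rule bounded_linear.has_derivative[OF L[unfolded linear_conv_bounded_linear] Z])
    from has_derivative_add[OF this B.FDERIV[OF has_derivative_ident Z]]
    have "((\<lambda>w. J w (Z w)) has_derivative
        (\<lambda>h. J z (frechet_derivative Z (at z) h) + B h (Z z))) (at z)"
      by (simp add: J add.assoc)
    then show ?thesis
      by (rule frechet_derivative_at[symmetric])
  qed
  have "linear (J z)"
    unfolding J using L B by (auto intro!: linear_compose_add simp: bilinear_def)
  then show ?thesis
    by (simp add: nijenhuis_def lie_bracket_def deriv_J[OF X] deriv_J[OF Y] linear_add linear_diff)
qed

section \<open>The contact structure\<close>

lemma contact_theta_eq: "contact_theta z w = fst w + fst (snd z) \<bullet> snd (snd w)"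
  by (simp add: contact_theta_def inner_vec_def split: prod.splits)

lemma contact_phi_eq:
  "contact_phi z w = (fst (snd z) \<bullet> fst (snd w), snd (snd w), - fst (snd w))"
  by (simp add: contact_phi_def inner_vec_def split: prod.splits)

lemma contact_xi_eq: "contact_xi z = (1, 0, 0)"
  by (simp add: contact_xi_def)

lemmas contact_eqs = contact_theta_eq contact_phi_eq contact_xi_eq

lemma one_form_contact_theta: "one_form (contact_theta :: 'n::finite phase \<Rightarrow> _)"
proof -
  have "linear (\<lambda>z :: 'n phase. fst (snd z) \<bullet> snd (snd v))" for v :: "'n phase"
    by (rule linearI) (auto simp: inner_add_left)
  from smooth_affine[OF this] show ?thesis
    by (auto simp: one_form_def contact_theta_eq inner_add_right algebra_simps intro!: linearI)
qed

lemma tensor11_contact_phi: "tensor11 (contact_phi :: 'n::finite phase \<Rightarrow> _)"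
proof -
  have "smooth (\<lambda>z. contact_phi z v)" for v :: "'n phase"
  proof -
    have "linear (\<lambda>z :: 'n phase. (fst (snd z) \<bullet> fst (snd v), 0 :: (real^'n) \<times> (real^'n)))"
      by (rule linearI) (auto simp: inner_add_left zero_prod_def)
    from smooth_affine[OF this, of "(0, snd (snd v), - fst (snd v))"] show ?thesis
      by (simp add: contact_phi_eq zero_prod_def)
  qed
  then show ?thesis
    by (auto simp: tensor11_def contact_phi_eq inner_add_right intro!: linearI)
qed

text \<open>This is the wedge sum of dp_i and dx^i: only the coefficients p_i of \<theta> vary, and
  they do so linearly.\<close>

lemma ext_deriv_contact_theta:
  fixes z :: "'n::finite phase"
  shows "ext_deriv contact_theta z u v = fst (snd u) \<bullet> snd (snd v) - fst (snd v) \<bullet> snd (snd u)"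
proof -
  have "((\<lambda>w. contact_theta w v) has_derivative (\<lambda>h. fst (snd h) \<bullet> snd (snd v))) (at z)"
    for v
    unfolding contact_theta_eq by (auto intro!: derivative_eq_intros)
  from frechet_derivative_at[OF this] show ?thesis
    by (metis ext_deriv_def)
qed

lemma contact_form_contact_theta: "contact_form (contact_theta :: 'n::finite phase \<Rightarrow> _)"
proof -
  have "u = 0" if u: "contact_theta z u = 0"
    and ker: "\<forall>v. contact_theta z v = 0 \<longrightarrow> ext_deriv contact_theta z u v = 0"
    for z u :: "'n phase"
  proof -
    obtain a b c where abc: "u = (a, b, c)"
      by (cases u)
    \<comment> \<open>The test vector is \<open>- contact_phi z u\<close>; its first entry places it
      in the kernel of \<theta>.\<close>
    have "ext_deriv contact_theta z u (- (fst (snd z) \<bullet> b), - c, b) = 0"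
      using ker by (simp add: contact_theta_eq)
    then have "b \<bullet> b + c \<bullet> c = 0"
      by (simp add: ext_deriv_contact_theta abc)
    then have "b = 0" "c = 0"
      by (smt (verit) inner_eq_zero_iff inner_ge_zero)+
    with u abc show ?thesis
      by (simp add: contact_theta_eq zero_prod_def)
  qed
  moreover have "contact_theta z (contact_xi z) = 1" for z :: "'n phase"
    by (simp add: contact_eqs)
  then have "contact_theta z \<noteq> (\<lambda>_. 0)" for z :: "'n phase"
    by (metis zero_neq_one)
  ultimately show ?thesis
    using one_form_contact_theta by (auto simp: contact_form_def)
qed

lemma reeb_field_contact_xi: "reeb_field contact_xi contact_theta"
  \<comment> \<open>In \<open>smooth contact_xi\<close> the field stands without an argument, hence
    the separate rewrite rule for that proposition.\<close>
  by (simp add: reeb_field_def smooth_const contact_eqs ext_deriv_contact_theta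
      contact_xi_def[THEN arg_cong[where f = smooth]])

lemma almost_contact_contact: "almost_contact contact_phi contact_xi contact_theta"
  using reeb_field_contact_xi tensor11_contact_phi one_form_contact_theta
  by (auto simp: almost_contact_def reeb_field_def contact_eqs prod_eq_iff)

definition lorentz_metric :: "'n::finite phase \<Rightarrow> 'n phase \<Rightarrow> 'n phase \<Rightarrow> real" where
  "lorentz_metric z u v = - (contact_theta z u * contact_theta z v) + snd u \<bullet> snd v"

lemma pseudo_riemannian_lorentz_metric: "pseudo_riemannian (lorentz_metric :: 'n::finite phase \<Rightarrow> _)"
proof -
  have "smooth (\<lambda>z. lorentz_metric z u v)" for u v :: "'n phase"
  proof -
    \<comment> \<open>Multiplying out the two values of \<theta> gives a polynomial of degree two in
      the momentum.\<close>
    let ?l = "\<lambda>u z :: 'n phase. fst (snd z) \<bullet> snd (snd u)"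
    have l: "linear (?l u)" for u
      by (rule linearI) (auto simp: inner_add_left)
    then have "linear (\<lambda>z. - fst u * ?l v z - fst v * ?l u z)"
      by (auto intro!: linearI simp: linear_add linear_cmul algebra_simps)
    moreover have "bilinear (\<lambda>z w. - (?l u z * ?l v w))"
      unfolding bilinear_def using l
      by (auto intro!: linearI simp: linear_add linear_cmul algebra_simps)
    ultimately have
      "smooth (\<lambda>z. (snd u \<bullet> snd v - fst u * fst v) + (- fst u * ?l v z - fst v * ?l u z)
        + - (?l u z * ?l v z))"
      by (rule smooth_quadratic)
    then show ?thesis
      by (simp add: lorentz_metric_def contact_theta_eq algebra_simps)
  qed
  moreover have "bilinear (lorentz_metric z)" for z :: "'n phase"
    unfolding bilinear_def lorentz_metric_def contact_theta_eq
    by (auto intro!: linearI simp: inner_add_right inner_add_left algebra_simps)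
  moreover have "lorentz_metric z u v = lorentz_metric z v u" for z u v :: "'n phase"
    by (simp add: lorentz_metric_def inner_commute mult.commute)
  moreover have "u = 0" if "\<forall>v. lorentz_metric z u v = 0" for z u :: "'n phase"
  proof -
    \<comment> \<open>Pairing with the Reeb field gives \<theta>(u) = 0; pairing \<open>u\<close>
      with itself then leaves the squared norm of \<open>snd u\<close>.\<close>
    have "lorentz_metric z u (1, 0) = 0" "lorentz_metric z u u = 0"
      using that by blast+
    then have "contact_theta z u = 0" "snd u = 0"
      by (simp_all add: lorentz_metric_def contact_theta_eq[of z "(1, 0)"])
    then show ?thesis
      by (simp add: contact_theta_eq prod_eq_iff)
  qed
  ultimately show ?thesis
    unfolding pseudo_riemannian_def by blast
qed

lemma indefinite_metric_lorentz_metric: "indefinite_metric (lorentz_metric :: 'n::finite phase \<Rightarrow> _)"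
proof -
  \<comment> \<open>The first vector has all momentum entries 1 and lies in the kernel of \<theta>;
    the second is the Reeb field.\<close>
  have "lorentz_metric z (0, 1, 0) (0, 1, 0) > 0" "lorentz_metric z (1, 0, 0) (1, 0, 0) < 0"
    for z :: "'n phase"
    by (auto simp: lorentz_metric_def contact_theta_eq)
  with pseudo_riemannian_lorentz_metric show ?thesis
    unfolding indefinite_metric_def by blast
qed

lemma associated_metric_lorentz_metric:
  "associated_metric lorentz_metric contact_phi contact_xi contact_theta"
  unfolding associated_metric_def
  \<comment> \<open>The sign is -1 because g(\<xi>,\<xi>) = -1. The second condition holds as
    \<theta> vanishes on the image of \<phi>, which acts on the last two blocks as a
    rotation.\<close>
  by (rule bexI[of _ "-1"])
    (auto simp: lorentz_metric_def ext_deriv_contact_theta contact_eqs inner_prod_def inner_commute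
      algebra_simps)

section \<open>The symplectization\<close>

abbreviation contact_J :: "'n::finite sympl \<Rightarrow> 'n sympl \<Rightarrow> 'n sympl" where
  "contact_J \<equiv> sympl_J contact_phi contact_xi contact_theta"

definition momentum :: "'n::finite sympl \<Rightarrow> real^'n" where
  "momentum z = fst (snd (fst z))"

definition position :: "'n::finite sympl \<Rightarrow> real^'n" where
  "position z = snd (snd (fst z))"

lemma linear_momentum: "linear momentum"
  by (rule linearI) (auto simp: momentum_def)

text \<open>The value of \<open>contact_J\<close> at zero momentum; \<open>J_lin\<close> is the
  remainder, linear in the base point.\<close>

definition J_const :: "'n::finite sympl \<Rightarrow> 'n sympl" where
  "J_const w = ((- snd w, position w, - momentum w), fst (fst w))"

definition J_lin :: "'n::finite sympl \<Rightarrow> 'n sympl \<Rightarrow> 'n sympl" where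
  "J_lin z w = ((momentum z \<bullet> momentum w, 0, 0), momentum z \<bullet> position w)"

lemma linear_J_const: "linear J_const"
  by (rule linearI) (auto simp: J_const_def momentum_def position_def)

lemma bilinear_J_lin: "bilinear J_lin"
  by (auto simp: bilinear_def J_lin_def momentum_def position_def inner_add_left inner_add_right
      intro!: linearI)

lemma contact_J_decomp: "contact_J z w = J_const w + J_lin z w"
  by (cases z; cases w)
    (auto simp: sympl_J_def J_const_def J_lin_def contact_eqs momentum_def position_def)

lemma almost_complex_contact_J: "almost_complex (contact_J :: 'n::finite sympl \<Rightarrow> _)"
proof -
  have "linear (contact_J z)" for z :: "'n sympl"
    using linear_J_const bilinear_J_lin unfolding contact_J_decomp bilinear_def
    by (intro linear_compose_add; blast)
  moreover have "smooth (\<lambda>z. contact_J z v)" for v :: "'n sympl"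
    using bilinear_J_lin unfolding contact_J_decomp bilinear_def
    by (intro smooth_affine) blast
  moreover have "contact_J z (contact_J z v) = - v" for z v :: "'n sympl"
    by (auto simp: contact_J_decomp J_const_def J_lin_def momentum_def position_def prod_eq_iff)
  ultimately show ?thesis
    by (simp add: almost_complex_def tensor11_def)
qed

lemma nijenhuis_contact_J:
  assumes "smooth X" and "smooth Y"
  shows "nijenhuis contact_J X Y z = 0"
proof -
  have "nijenhuis contact_J X Y z = J_lin (contact_J z (X z)) (Y z) - J_lin (contact_J z (Y z)) (X z)
      + contact_J z (J_lin (Y z) (X z)) - contact_J z (J_lin (X z) (Y z))"
    using assms
    by (intro nijenhuis_affine[OF linear_J_const bilinear_J_lin contact_J_decomp]
        smooth_imp_differentiable)
  \<comment> \<open>The first two terms leave a multiple of \<xi>. The difference of the two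
    \<open>J_lin\<close> terms under \<open>contact_J\<close> is the same multiple of the
    t-direction, which J sends to -\<xi>.\<close>
  also have "\<dots> = 0"
    by (auto simp: contact_J_decomp J_const_def J_lin_def momentum_def position_def prod_eq_iff
        inner_commute)
  finally show ?thesis .
qed

section \<open>Global complex coordinates\<close>

definition chart_lin :: "'n::finite sympl \<Rightarrow> complex^('n option)" where
  "chart_lin z = (\<chi> j. case j of None \<Rightarrow> Complex (fst (fst z)) (snd z)
     | Some i \<Rightarrow> Complex (position z $ i) (momentum z $ i))"

text \<open>The correction is forced: dx^0 composed with J is p dp - dt, and the imaginary part
  completing x^0 must have minus this as its differential.\<close>

definition chart :: "'n::finite sympl \<Rightarrow> complex^('n option)" where
  "chart z = chart_lin z - ((momentum z \<bullet> momentum z) / 2) *\<^sub>R axis None \<i>"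

definition chart_inv_lin :: "complex^('n option) \<Rightarrow> 'n::finite sympl" where
  "chart_inv_lin w =
     ((Re (w $ None), \<chi> i. Im (w $ Some i), \<chi> i. Re (w $ Some i)), Im (w $ None))"

definition chart_inv :: "complex^('n option) \<Rightarrow> 'n::finite sympl" where
  "chart_inv w = chart_inv_lin w
     + ((momentum (chart_inv_lin w) \<bullet> momentum (chart_inv_lin w)) / 2) *\<^sub>R (0, 1)"

lemma linear_chart_lin: "linear chart_lin"
  by (rule linearI)
    (auto simp: chart_lin_def momentum_def position_def vec_eq_iff complex_eq_iff split: option.splits)

lemma linear_chart_inv_lin: "linear chart_inv_lin"
  by (rule linearI) (auto simp: chart_inv_lin_def vec_eq_iff)

lemma chart_inv_chart: "chart_inv (chart z) = z"
  by (auto simp: chart_inv_def chart_def chart_inv_lin_def chart_lin_def axis_def momentum_def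
      position_def prod_eq_iff vec_eq_iff inner_vec_def)

lemma chart_chart_inv: "chart (chart_inv w) = w"
proof -
  \<comment> \<open>The correction changes only t, so \<open>chart\<close> subtracts exactly what
    \<open>chart_inv\<close> added.\<close>
  have "momentum (chart_inv w) = momentum (chart_inv_lin w)"
    by (simp add: chart_inv_def momentum_def)
  then show ?thesis
    by (auto simp: vec_eq_iff complex_eq_iff chart_def chart_lin_def axis_def chart_inv_def
        chart_inv_lin_def momentum_def position_def split: option.splits)
qed

lemma bij_chart: "bij chart"
  by (rule bij_betw_byWitness[of _ chart_inv]) (auto simp: chart_inv_chart chart_chart_inv)

lemma inv_chart: "inv chart = chart_inv"
  by (rule inv_equality) (simp_all add: chart_inv_chart chart_chart_inv)

lemma smooth_chart: "smooth (chart :: 'n::finite sympl \<Rightarrow> _)"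
proof -
  have "bilinear (\<lambda>z w :: 'n sympl. - ((momentum z \<bullet> momentum w) / 2) *\<^sub>R axis (None :: 'n option) \<i>)"
    unfolding bilinear_def
    by (auto intro!: linearI simp: momentum_def inner_add_left inner_add_right add_divide_distrib
        algebra_simps)
  from smooth_quadratic[OF linear_chart_lin this, of 0] show ?thesis
    by (simp add: chart_def[abs_def])
qed

lemma smooth_chart_inv: "smooth (chart_inv :: _ \<Rightarrow> 'n::finite sympl)"
proof -
  have "bilinear (\<lambda>z w. ((momentum (chart_inv_lin z :: 'n sympl)
      \<bullet> momentum (chart_inv_lin w :: 'n sympl)) / 2) *\<^sub>R (0 :: 'n phase, 1 :: real))"
    unfolding bilinear_def
    by (auto intro!: linearI simp: linear_add[OF linear_chart_inv_lin]
        linear_cmul[OF linear_chart_inv_lin] momentum_def inner_add_left inner_add_right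
        add_divide_distrib scaleR_left_distrib)
  from smooth_quadratic[OF linear_chart_inv_lin this, of 0] show ?thesis
    by (simp add: chart_inv_def[abs_def])
qed

lemma frechet_derivative_chart:
  "frechet_derivative chart (at z)
    = (\<lambda>h. chart_lin h - (momentum z \<bullet> momentum h) *\<^sub>R axis None \<i>)"
proof -
  have "(chart has_derivative (\<lambda>h. chart_lin h - (momentum z \<bullet> momentum h) *\<^sub>R axis None \<i>)) (at z)"
    unfolding chart_def[abs_def]
    by (auto intro!: derivative_eq_intros linear_imp_has_derivative linear_chart_lin linear_momentum
        simp: inner_commute)
  then show ?thesis
    by (rule frechet_derivative_at[symmetric])
qed

text \<open>At index \<open>None\<close>, the term p dx that \<theta> contributes is cancelled by
  the derivative of the quadratic correction, since the momentum of \<open>contact_J z v\<close> is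
  the position of \<open>v\<close>.\<close>

lemma frechet_derivative_chart_contact_J:
  "frechet_derivative chart (at z) (contact_J z v) = \<i> *s frechet_derivative chart (at z) v"
  by (auto simp: frechet_derivative_chart contact_J_decomp J_const_def J_lin_def chart_lin_def
      momentum_def position_def vec_eq_iff complex_eq_iff axis_def split: option.splits)

lemma complex_manifold_contact_J: "complex_manifold (contact_J :: 'n::finite sympl \<Rightarrow> _)"
proof -
  let ?A = "{(UNIV, chart)} :: ('n sympl set \<times> ('n sympl \<Rightarrow> complex^('n option))) set"
  have "range chart = (UNIV :: (complex^('n option)) set)" "inj (chart :: 'n sympl \<Rightarrow> _)"
    using bij_chart by (auto simp: bij_def)
  \<comment> \<open>The atlas has one chart, so its only transition map is the identity.\<close>
  moreover have "cholomorphic_on (chart \<circ> chart_inv) (UNIV :: (complex^('n option)) set)"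
    by (auto simp: cholomorphic_on_def o_def chart_chart_inv intro!: exI[of _ "\<lambda>h. h"])
  ultimately have "complex_atlas ?A"
    by (simp add: complex_atlas_def inv_chart smooth_chart smooth_chart_inv)
  moreover have "induces_acs ?A contact_J"
    by (simp add: induces_acs_def frechet_derivative_chart_contact_J)
  ultimately show ?thesis
    using almost_complex_contact_J by (auto simp: complex_manifold_def)
qed

theorem proposition7:
  fixes J :: "'n::finite sympl \<Rightarrow> 'n sympl \<Rightarrow> 'n sympl"
  assumes J_def: "J = sympl_J contact_phi contact_xi contact_theta"
  shows "almost_complex J
    \<and> (\<forall>X Y. smooth X \<and> smooth Y \<longrightarrow> (\<forall>z. nijenhuis J X Y z = 0))
    \<and> complex_manifold J
    \<and> indefinite_sasakian (contact_phi :: 'n phase \<Rightarrow> 'n phase \<Rightarrow> 'n phase) contact_xi contact_theta"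
  using almost_complex_contact_J nijenhuis_contact_J complex_manifold_contact_J almost_contact_contact
    contact_form_contact_theta reeb_field_contact_xi indefinite_metric_lorentz_metric
    associated_metric_lorentz_metric
  unfolding J_def indefinite_sasakian_def by blast

end
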